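(* Let $\alpha,\beta>0$, $U=L^2(D;\mathbb{R}^2)$, $\mathcal{G}(u)=\int_D g(u(x))\,dx$ with $g(v)=\frac\alpha2(v_1^2+v_2^2)+\beta|v_1v_2|_0$, and $\mathcal{F}(u)=\frac12\|Su-z\|_Y^2$, and set $\mathcal{J}=\mathcal{F}+\mathcal{G}$. If $(\bar u,\bar p)\in U\times U$ satisfies $$\bar p=-S^*(S\bar u-z),\qquad\bar u\in\partial\mathcal{G}^*(\bar p),$$ then for any $u\in U$, $$\mathcal{J}(\bar u)\le\mathcal{J}(u)+\beta\left(|\partial\mathcal{I}|+2|\mathcal{S}|\right),$$ where $\partial\mathcal{I}=\{x\in D:\bar p(x)\in Q_{10}\cup Q_{20}\}$ and $\mathcal{S}=\{x\in D:\bar p(x)\in Q_{12}\setminus\{(0,0)\}\}$. Hence if $\partial\mathcal{I}$ and $\mathcal{S}$ are sets of Lebesgue measure zero, $\bar u$ is a solution to $\min_{u\in U}\mathcal{J}(u)$.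
   Context: $D\subset\mathbb{R}^d$ ($d\ge1$) is a measurable set of finite Lebesgue measure (so that $\mathcal{G}:U\to\mathbb{R}$ is real-valued). $Y$ is a real Hilbert space identified with its dual, $z\in Y$ is given, and $S:U\to Y$ is a bounded linear operator with adjoint $S^*:Y\to U$; it is assumed that there is a Banach space $V$ continuously embedded in $L^r(D;\mathbb{R}^2)$ for some $r>2$ such that $S^*$ maps $Y$ continuously into $V$. $|t|_0=1$ if $t\ne0$ and $|0|_0=0$. $\mathcal{G}^*(p)=\sup_{u\in U}\langle u,p\rangle_U-\mathcal{G}(u)$ is the Fenchel conjugate on $U$ (identified with its dual) and $\partial\mathcal{G}^*$ its convex subdifferential. $|A|$ denotes the Lebesgue measure of $A\subset D$. The sets are $Q_{10}=\{q\in\mathbb{R}^2:|q_1|>|q_2|=\sqrt{2\alpha\beta}\}$, $Q_{20}=\{q\in\mathbb{R}^2:|q_2|>|q_1|=\sqrt{2\alpha\beta}\}$, $Q_{12}=\{q\in\mathbb{R}^2:|q_1|=|q_2|\le\sqrt{2\alpha\beta}\}$. (Note that $\partial\mathcal{I}$ is just notation and not a topological boundary.) *)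

theory Defs
  imports "HOL-Analysis.Analysis"
begin

text \<open>
  Elements of the Lebesgue spaces over \<^term>\<open>D\<close> are represented by functions on the whole
  Euclidean space, of which only the values on \<^term>\<open>D\<close> matter; equality in \<open>L\<^sup>p\<close> is equality
  almost everywhere with respect to \<^term>\<open>lebesgue_on D\<close>.
\<close>

type_synonym 'd field2 = "real^'d \<Rightarrow> real^2"

definition Lp :: "real \<Rightarrow> (real^'d::finite) set \<Rightarrow> 'd field2 set" where
  "Lp r D = {f. f \<in> borel_measurable (lebesgue_on D) \<and>
                integrable (lebesgue_on D) (\<lambda>x. norm (f x) powr r)}"

definition Lp_norm :: "real \<Rightarrow> (real^'d::finite) set \<Rightarrow> 'd field2 \<Rightarrow> real" where
  "Lp_norm r D f = (integral\<^sup>L (lebesgue_on D) (\<lambda>x. norm (f x) powr r)) powr (1 / r)"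

abbreviation L2 :: "(real^'d::finite) set \<Rightarrow> 'd field2 set" where
  "L2 \<equiv> Lp 2"

definition L2_inner :: "(real^'d::finite) set \<Rightarrow> 'd field2 \<Rightarrow> 'd field2 \<Rightarrow> real" where
  "L2_inner D u v = integral\<^sup>L (lebesgue_on D) (\<lambda>x. u x \<bullet> v x)"

text \<open>
  Linearity together with the norm bound forces such an operator to take equal values on
  functions that agree almost everywhere on \<^term>\<open>D\<close>, so it is an operator on \<open>L\<^sup>2\<close>.
\<close>

definition bounded_linear_L2 ::
    "(real^'d::finite) set \<Rightarrow> ('d field2 \<Rightarrow> 'y::real_normed_vector) \<Rightarrow> bool" where
  "bounded_linear_L2 D S \<longleftrightarrow>
     (\<forall>u\<in>L2 D. \<forall>v\<in>L2 D. S (\<lambda>x. u x + v x) = S u + S v) \<and>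
     (\<forall>c. \<forall>u\<in>L2 D. S (\<lambda>x. c *\<^sub>R u x) = c *\<^sub>R S u) \<and>
     (\<exists>C. \<forall>u\<in>L2 D. norm (S u) \<le> C * Lp_norm 2 D u)"

text \<open>This determines the values of the adjoint up to equality almost everywhere.\<close>

definition is_adjoint_L2 ::
    "(real^'d::finite) set \<Rightarrow> ('d field2 \<Rightarrow> 'y::real_inner) \<Rightarrow> ('y \<Rightarrow> 'd field2) \<Rightarrow> bool" where
  "is_adjoint_L2 D S Sadj \<longleftrightarrow>
     (\<forall>y. Sadj y \<in> L2 D \<and> (\<forall>u\<in>L2 D. S u \<bullet> y = L2_inner D u (Sadj y)))"

definition continuous_embedding_Lp ::
    "real \<Rightarrow> (real^'d::finite) set \<Rightarrow> ('v::real_normed_vector \<Rightarrow> 'd field2) \<Rightarrow> bool" where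
  "continuous_embedding_Lp r D emb \<longleftrightarrow>
     (\<forall>v. emb v \<in> Lp r D) \<and>
     (\<forall>v w. AE x in lebesgue_on D. emb (v + w) x = emb v x + emb w x) \<and>
     (\<forall>c v. AE x in lebesgue_on D. emb (c *\<^sub>R v) x = c *\<^sub>R emb v x) \<and>
     (\<forall>v w. (AE x in lebesgue_on D. emb v x = emb w x) \<longrightarrow> v = w) \<and>
     (\<exists>C. \<forall>v. Lp_norm r D (emb v) \<le> C * norm v)"

definition fenchel_conj_L2 ::
    "(real^'d::finite) set \<Rightarrow> ('d field2 \<Rightarrow> real) \<Rightarrow> 'd field2 \<Rightarrow> ereal" where
  "fenchel_conj_L2 D G p = (SUP u\<in>L2 D. ereal (L2_inner D u p - G u))"

text \<open>As usual, the subdifferential is empty at points where the functional is not finite.\<close>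

definition subdifferential_L2 ::
    "(real^'d::finite) set \<Rightarrow> ('d field2 \<Rightarrow> ereal) \<Rightarrow> 'd field2 \<Rightarrow> 'd field2 set" where
  "subdifferential_L2 D H p =
     {u \<in> L2 D. \<bar>H p\<bar> \<noteq> \<infinity> \<and>
        (\<forall>q\<in>L2 D. H p + ereal (L2_inner D u (\<lambda>x. q x - p x)) \<le> H q)}"

definition abs0 :: "real \<Rightarrow> real" where
  "abs0 t = (if t = 0 then 0 else 1)"

definition g_fun :: "real \<Rightarrow> real \<Rightarrow> real^2 \<Rightarrow> real" where
  "g_fun \<alpha> \<beta> v = \<alpha> / 2 * ((v$1)\<^sup>2 + (v$2)\<^sup>2) + \<beta> * abs0 (v$1 * v$2)"

definition G_fun :: "real \<Rightarrow> real \<Rightarrow> (real^'d::finite) set \<Rightarrow> 'd field2 \<Rightarrow> real" where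
  "G_fun \<alpha> \<beta> D u = integral\<^sup>L (lebesgue_on D) (\<lambda>x. g_fun \<alpha> \<beta> (u x))"

definition F_fun :: "('d::finite field2 \<Rightarrow> 'y::real_inner) \<Rightarrow> 'y \<Rightarrow> 'd field2 \<Rightarrow> real" where
  "F_fun S z u = 1 / 2 * (norm (S u - z))\<^sup>2"

definition J_fun ::
    "real \<Rightarrow> real \<Rightarrow> (real^'d::finite) set \<Rightarrow> ('d field2 \<Rightarrow> 'y::real_inner) \<Rightarrow> 'y \<Rightarrow> 'd field2 \<Rightarrow> real" where
  "J_fun \<alpha> \<beta> D S z u = F_fun S z u + G_fun \<alpha> \<beta> D u"

definition Q10 :: "real \<Rightarrow> real \<Rightarrow> (real^2) set" where
  "Q10 \<alpha> \<beta> = {q. \<bar>q$1\<bar> > \<bar>q$2\<bar> \<and> \<bar>q$2\<bar> = sqrt (2 * \<alpha> * \<beta>)}"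

definition Q20 :: "real \<Rightarrow> real \<Rightarrow> (real^2) set" where
  "Q20 \<alpha> \<beta> = {q. \<bar>q$2\<bar> > \<bar>q$1\<bar> \<and> \<bar>q$1\<bar> = sqrt (2 * \<alpha> * \<beta>)}"

definition Q12 :: "real \<Rightarrow> real \<Rightarrow> (real^2) set" where
  "Q12 \<alpha> \<beta> = {q. \<bar>q$1\<bar> = \<bar>q$2\<bar> \<and> \<bar>q$2\<bar> \<le> sqrt (2 * \<alpha> * \<beta>)}"

definition boundary_set ::
    "real \<Rightarrow> real \<Rightarrow> (real^'d::finite) set \<Rightarrow> 'd field2 \<Rightarrow> (real^'d) set" where
  "boundary_set \<alpha> \<beta> D p = {x \<in> D. p x \<in> Q10 \<alpha> \<beta> \<union> Q20 \<alpha> \<beta>}"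

definition singular_set ::
    "real \<Rightarrow> real \<Rightarrow> (real^'d::finite) set \<Rightarrow> 'd field2 \<Rightarrow> (real^'d) set" where
  "singular_set \<alpha> \<beta> D p = {x \<in> D. p x \<in> Q12 \<alpha> \<beta> - {0}}"

end

theory Submission imports Defs begin

text \<open>
  Why the estimate holds. By Fenchel-Young, every \<open>u\<close> satisfies
  \<open>\<langle>u, p\<rangle> \<le> \<G>(u) + \<G>\<^sup>*(p)\<close>. If \<open>\<G>\<close> were convex, the condition
  \<open>u\<^sub>0 \<in> \<partial>\<G>\<^sup>*(p)\<close> would force equality at \<open>u\<^sub>0\<close>, and together with convexity of
  \<open>\<F>\<close>, whose gradient at \<open>u\<^sub>0\<close> is \<open>-p\<close>, this would make \<open>u\<^sub>0\<close> a minimizer. As \<open>\<G>\<close>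
  is not convex, \<open>u\<^sub>0\<close> may have a positive gap \<open>\<G>(u\<^sub>0) + \<G>\<^sup>*(p) - \<langle>u\<^sub>0, p\<rangle>\<close>, and adding the
  inequalities for \<open>u\<close> and \<open>u\<^sub>0\<close> shows that \<open>u\<^sub>0\<close> is optimal up to this gap.

  The gap is an integral over \<open>D\<close> and is estimated pointwise. The conjugate \<open>g\<^sup>*\<close> of the
  integrand is a maximum of three parabolas, and it is attained by an explicit Borel selection,
  so \<open>\<G>\<^sup>*\<close> is the integral of \<open>g\<^sup>*\<close> (lemma \<open>fenchel_conj_eq_integral\<close>). Modifying the test
  function on a measurable set turns the global subgradient inequality into
  \<open>u\<^sub>0(x) \<in> \<partial>g\<^sup>*(p(x))\<close> for almost every \<open>x\<close> (lemma \<open>subdifferential_pointwise\<close>). Where \<open>g\<^sup>*\<close>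
  is differentiable its gradient is the maximizer and the pointwise gap vanishes. The kinks of
  \<open>g\<^sup>*\<close> are \<open>Q\<^sub>1\<^sub>0\<close>, \<open>Q\<^sub>2\<^sub>0\<close> and \<open>Q\<^sub>1\<^sub>2 - {0}\<close>; there the gap is at most \<open>\<beta>\<close>, \<open>\<beta>\<close> and
  \<open>2\<beta>\<close> (lemma \<open>fenchel_gap_bound\<close>), which integrates to the bound in the theorem.
\<close>

section \<open>Subgradients of a truncated parabola\<close>

text \<open>
  Along a coordinate line \<open>g\<^sup>*\<close> has the form \<open>t \<mapsto> max A (t\<^sup>2/(2\<alpha>) + B)\<close>. The three lemmas
  below locate the subgradients of such a function: on the flat part, on the parabola, and, with
  no case distinction, by an inequality that still applies at the kink between them.
\<close>

text \<open>
  It says that \<open>\<alpha>/2 v\<^sup>2 - v s \<le> 0\<close>: the contribution of one coordinate to \<open>g(v) - v \<cdot> q\<close>,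
  apart from the switching cost, is not positive. A subgradient lies between \<open>0\<close> and \<open>s/\<alpha>\<close>, so it
  even satisfies \<open>\<alpha> v\<^sup>2 \<le> v s\<close>; the weaker form suffices and needs a single test point.
\<close>
lemma truncated_parabola_subgradient_growth:
  fixes A B s v \<alpha> :: real
  assumes "\<alpha> > 0"
    and sub: "\<And>t. max A (s\<^sup>2/(2*\<alpha>) + B) + v * (t - s) \<le> max A (t\<^sup>2/(2*\<alpha>) + B)"
  shows "\<alpha> * v\<^sup>2 \<le> 2 * v * s"
proof (cases "v = 0")
  case False
  define P where "P = s\<^sup>2/(2*\<alpha>) + B"
  \<comment> \<open>At \<open>t = s + \<alpha> v\<close> the linear term gains \<open>\<alpha> v\<^sup>2\<close>, but the parabola only
    \<open>s v + \<alpha> v\<^sup>2/2\<close>.\<close>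
  have sq: "(s + \<alpha> * v)\<^sup>2/(2*\<alpha>) + B = P + s * v + \<alpha> * v\<^sup>2 / 2"
    using assms(1) by (simp add: P_def field_simps power2_eq_square)
  have "max A P + \<alpha> * v\<^sup>2 \<le> max A (P + s * v + \<alpha> * v\<^sup>2 / 2)"
    using sub[of "s + \<alpha> * v"] unfolding sq unfolding P_def[symmetric]
    by (simp add: power2_eq_square algebra_simps)
  moreover have "\<alpha> * v\<^sup>2 > 0" using False assms(1) by simp
  ultimately show ?thesis by (auto simp: max_def algebra_simps split: if_splits)
qed simp

lemma truncated_parabola_subgradient_flat:
  fixes A B s v \<alpha> :: real
  assumes "\<alpha> > 0"
    and sub: "\<And>t. max A (s\<^sup>2/(2*\<alpha>) + B) + v * (t - s) \<le> max A (t\<^sup>2/(2*\<alpha>) + B)"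
    and flat: "s\<^sup>2/(2*\<alpha>) + B < A"
  shows "v = 0"
proof -
  \<comment> \<open>The flat part is the interval \<open>[-\<rho>, \<rho>]\<close>; testing both endpoints rules out either sign
    of \<open>v\<close>.\<close>
  define \<rho> where "\<rho> = sqrt (2*\<alpha>*(A - B))"
  have s2: "s\<^sup>2 < 2*\<alpha>*(A - B)"
    using flat assms(1) by (simp add: field_simps)
  then have nn: "0 \<le> 2*\<alpha>*(A - B)" using zero_le_power2[of s] by linarith
  have "\<bar>s\<bar> < \<rho>" using s2 unfolding \<rho>_def by (metis real_sqrt_abs real_sqrt_less_iff)
  have sq: "\<rho>\<^sup>2/(2*\<alpha>) + B = A" using nn assms(1) by (simp add: \<rho>_def)
  have "v * (\<rho> - s) \<le> 0" "v * (- \<rho> - s) \<le> 0"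
    using sub[of \<rho>] sub[of "-\<rho>"] sq flat by auto
  with \<open>\<bar>s\<bar> < \<rho>\<close> show ?thesis by (auto simp: mult_le_0_iff)
qed

lemma truncated_parabola_subgradient_curved:
  fixes A B s v \<alpha> :: real
  assumes "\<alpha> > 0"
    and sub: "\<And>t. max A (s\<^sup>2/(2*\<alpha>) + B) + v * (t - s) \<le> max A (t\<^sup>2/(2*\<alpha>) + B)"
    and curved: "A < s\<^sup>2/(2*\<alpha>) + B"
  shows "v = s / \<alpha>"
proof -
  \<comment> \<open>Near \<open>s\<close> the truncation is inactive, so \<open>s\<close> is a local minimum of this smooth function.\<close>
  define f where "f = (\<lambda>t. t\<^sup>2/(2*\<alpha>) + B - v * t)"
  have "((\<lambda>t. t\<^sup>2/(2*\<alpha>) + B) \<longlongrightarrow> s\<^sup>2/(2*\<alpha>) + B) (at s)"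
    using assms(1) by (intro tendsto_intros) auto
  then have "\<forall>\<^sub>F t in at s. A < t\<^sup>2/(2*\<alpha>) + B"
    using curved by (rule order_tendstoD)
  then obtain d where d: "d > 0" "\<And>t. t \<noteq> s \<Longrightarrow> dist t s < d \<Longrightarrow> A < t\<^sup>2/(2*\<alpha>) + B"
    unfolding eventually_at by blast
  have min: "\<forall>t. \<bar>s - t\<bar> < d \<longrightarrow> f s \<le> f t"
  proof (intro allI impI)
    fix t assume "\<bar>s - t\<bar> < d"
    then have "A < t\<^sup>2/(2*\<alpha>) + B"
      using d(2)[of t] curved by (cases "t = s") (auto simp: dist_real_def)
    with sub[of t] curved show "f s \<le> f t" by (simp add: f_def algebra_simps)
  qed
  have "DERIV f s :> s / \<alpha> - v"
    unfolding f_def using assms(1) by (auto intro!: derivative_eq_intros)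
  from DERIV_local_min[OF this d(1) min] show ?thesis by simp
qed

section \<open>The pointwise Fenchel gap\<close>

text \<open>
  The conjugate \<open>g\<^sup>*\<close> at \<open>(a, b)\<close>. The terms under the maximum are the suprema of
  \<open>v \<cdot> q - g(v)\<close> over \<open>v\<^sub>2 = 0\<close>, over \<open>v\<^sub>1 = 0\<close>, and of the same expression with the full cost
  \<open>\<beta>\<close> over all \<open>v\<close>. Taking the two coordinates as separate arguments makes the symmetry under
  their exchange usable.
\<close>
definition conj_density :: "real \<Rightarrow> real \<Rightarrow> real \<Rightarrow> real \<Rightarrow> real" where
  "conj_density \<alpha> \<beta> a b = max (max (a\<^sup>2 / (2*\<alpha>)) (b\<^sup>2 / (2*\<alpha>))) ((a\<^sup>2 + b\<^sup>2) / (2*\<alpha>) - \<beta>)"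

text \<open>
  The factor of \<open>\<beta>\<close> in the gap bound: twice the indicator of \<open>Q\<^sub>1\<^sub>2 - {0}\<close> plus the
  indicator of \<open>Q\<^sub>1\<^sub>0 \<union> Q\<^sub>2\<^sub>0\<close>, in a form symmetric in the coordinates.
\<close>
definition gap_weight :: "real \<Rightarrow> real \<Rightarrow> real \<Rightarrow> real \<Rightarrow> real" where
  "gap_weight \<alpha> \<beta> a b =
     (if \<bar>a\<bar> = \<bar>b\<bar> then (if a \<noteq> 0 \<and> a\<^sup>2 \<le> 2*\<alpha>*\<beta> then 2 else 0)
      else if min (a\<^sup>2) (b\<^sup>2) = 2*\<alpha>*\<beta> then 1 else 0)"

lemma conj_density_section:
  assumes "\<alpha> > 0"
  shows "conj_density \<alpha> \<beta> s b = max (b\<^sup>2/(2*\<alpha>)) (s\<^sup>2/(2*\<alpha>) + max 0 (b\<^sup>2/(2*\<alpha>) - \<beta>))"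
  by (auto simp: conj_density_def max_def add_divide_distrib)

lemma conj_density_commute: "conj_density \<alpha> \<beta> a b = conj_density \<alpha> \<beta> b a"
  by (simp add: conj_density_def max.commute add.commute)

lemma gap_weight_commute: "gap_weight \<alpha> \<beta> a b = gap_weight \<alpha> \<beta> b a"
proof -
  have "\<bar>a\<bar> = \<bar>b\<bar> \<Longrightarrow> a\<^sup>2 = b\<^sup>2" by (metis power2_abs)
  then show ?thesis by (auto simp: gap_weight_def min.commute)
qed

text \<open>
  Write \<open>P = a\<^sup>2/(2\<alpha>) \<ge> Q = b\<^sup>2/(2\<alpha>)\<close>. A coordinate on its parabola contributes exactly
  \<open>-P\<close> or \<open>-Q\<close> to \<open>g(v) - v \<cdot> q\<close>, a flat one contributes \<open>0\<close>, and any coordinate contributes at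
  most \<open>0\<close>. If \<open>P > Q\<close>, the first coordinate is on its parabola; the second is flat for \<open>Q < \<beta>\<close>
  and on its parabola for \<open>Q > \<beta>\<close>, with gap \<open>0\<close> both times, while for \<open>Q = \<beta>\<close> the conjugate
  is \<open>P\<close> and only the switching cost \<open>\<beta>\<close> is lost. If \<open>P = Q \<le> \<beta>\<close>, the gap is at most the
  switching cost plus the conjugate \<open>P\<close>, hence at most \<open>2\<beta>\<close>, and at \<open>a = b = 0\<close> it vanishes
  because \<open>v\<close> does; if \<open>P = Q > \<beta>\<close>, both coordinates are on their parabolas and the gap vanishes
  again.
\<close>
lemma fenchel_gap_bound_ordered:
  assumes \<alpha>: "\<alpha> > 0" and \<beta>: "\<beta> > 0" and ord: "\<bar>b\<bar> \<le> \<bar>a\<bar>"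
    and sub1: "\<And>t. conj_density \<alpha> \<beta> a b + v * (t - a) \<le> conj_density \<alpha> \<beta> t b"
    and sub2: "\<And>t. conj_density \<alpha> \<beta> a b + w * (t - b) \<le> conj_density \<alpha> \<beta> a t"
  shows "\<alpha>/2 * (v\<^sup>2 + w\<^sup>2) + \<beta> * abs0 (v * w) + conj_density \<alpha> \<beta> a b
         \<le> v * a + w * b + \<beta> * gap_weight \<alpha> \<beta> a b"
proof -
  define P where "P = a\<^sup>2/(2*\<alpha>)"
  define Q where "Q = b\<^sup>2/(2*\<alpha>)"
  have c: "conj_density \<alpha> \<beta> a b = max Q (P + max 0 (Q - \<beta>))"
    by (simp add: P_def Q_def conj_density_section[OF \<alpha>])
  have s1: "max Q (a\<^sup>2/(2*\<alpha>) + max 0 (Q - \<beta>)) + v * (t - a)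
            \<le> max Q (t\<^sup>2/(2*\<alpha>) + max 0 (Q - \<beta>))" for t
    using sub1[of t] unfolding Q_def by (simp add: conj_density_section[OF \<alpha>])
  have s2: "max P (b\<^sup>2/(2*\<alpha>) + max 0 (P - \<beta>)) + w * (t - b)
            \<le> max P (t\<^sup>2/(2*\<alpha>) + max 0 (P - \<beta>))" for t
    using sub2[of t] unfolding P_def conj_density_commute[of \<alpha> \<beta> a]
    by (simp add: conj_density_section[OF \<alpha>])
  have g1: "\<alpha>/2 * v\<^sup>2 \<le> v * a" and g2: "\<alpha>/2 * w\<^sup>2 \<le> w * b"
    using truncated_parabola_subgradient_growth[OF \<alpha> s1]
      truncated_parabola_subgradient_growth[OF \<alpha> s2] by simp_all
  have x: "abs0 (v * w) \<le> 1" "abs0 (v * w) \<ge> 0" by (auto simp: abs0_def)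
  then have bx: "\<beta> * abs0 (v * w) \<le> \<beta>" using \<beta> by (simp add: mult_left_le)
  have full1: "\<alpha>/2 * v\<^sup>2 = P \<and> v * a = 2 * P" if "v = a/\<alpha>"
    unfolding that P_def using \<alpha> by (simp add: power2_eq_square field_simps)
  have full2: "\<alpha>/2 * w\<^sup>2 = Q \<and> w * b = 2 * Q" if "w = b/\<alpha>"
    unfolding that Q_def using \<alpha> by (simp add: power2_eq_square field_simps)
  have thr: "b\<^sup>2 = 2*\<alpha>*\<beta> \<longleftrightarrow> Q = \<beta>" "a\<^sup>2 \<le> 2*\<alpha>*\<beta> \<longleftrightarrow> P \<le> \<beta>"
    using \<alpha> by (auto simp: P_def Q_def field_simps)
  show ?thesis
  proof (cases "\<bar>a\<bar> = \<bar>b\<bar>")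
    case False
    have "b\<^sup>2 < a\<^sup>2" using False ord by (simp add: abs_le_square_iff[symmetric] not_le[symmetric])
    then have QP: "Q < P" using \<alpha> by (simp add: P_def Q_def divide_strict_right_mono)
    have v: "v = a/\<alpha>"
      by (rule truncated_parabola_subgradient_curved[OF \<alpha> s1]) (use QP in \<open>simp add: P_def[symmetric]\<close>)
    have gw: "gap_weight \<alpha> \<beta> a b = (if Q = \<beta> then 1 else 0)"
      using False \<open>b\<^sup>2 < a\<^sup>2\<close> thr by (simp add: gap_weight_def min_def)
    consider "Q < \<beta>" | "Q = \<beta>" | "Q > \<beta>" by linarith
    then show ?thesis
    proof cases
      case 1
      have w: "w = 0"
        by (rule truncated_parabola_subgradient_flat[OF \<alpha> s2])
          (use 1 QP in \<open>simp add: Q_def[symmetric] max_def\<close>)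
      then show ?thesis using full1[OF v] 1 QP c gw by (simp add: abs0_def algebra_simps)
    next
      case 2
      then show ?thesis using full1[OF v] QP c gw g2 bx by (simp add: algebra_simps)
    next
      case 3
      have w: "w = b/\<alpha>"
        by (rule truncated_parabola_subgradient_curved[OF \<alpha> s2])
          (use 3 QP in \<open>simp add: Q_def[symmetric] max_def\<close>)
      then show ?thesis using full1[OF v] full2[OF w] 3 QP c gw bx by (simp add: algebra_simps)
    qed
  next
    case True
    then have "a\<^sup>2 = b\<^sup>2" by (metis power2_abs)
    then have PQ: "P = Q" by (simp add: P_def Q_def)
    consider "a = 0" | "a \<noteq> 0" "P \<le> \<beta>" | "P > \<beta>" by linarith
    then show ?thesis
    proof cases
      case 1
      then have "b = 0" using True by simp
      have "v = 0" "w = 0" using g1 g2 1 \<open>b = 0\<close> \<alpha> by (auto simp: mult_le_0_iff)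
      then show ?thesis using 1 \<open>b = 0\<close> \<beta> by (simp add: conj_density_def gap_weight_def abs0_def)
    next
      case 2
      then have "gap_weight \<alpha> \<beta> a b = 2" using True thr by (simp add: gap_weight_def)
      then show ?thesis using 2 PQ c g1 g2 bx by (simp add: algebra_simps)
    next
      case 3
      have "v = a/\<alpha>"
        by (rule truncated_parabola_subgradient_curved[OF \<alpha> s1])
          (use 3 PQ in \<open>simp add: P_def[symmetric] max_def\<close>)
      moreover have "w = b/\<alpha>"
        by (rule truncated_parabola_subgradient_curved[OF \<alpha> s2])
          (use 3 PQ in \<open>simp add: Q_def[symmetric] max_def\<close>)
      moreover have "gap_weight \<alpha> \<beta> a b = 0" using True thr 3 by (simp add: gap_weight_def)
      ultimately show ?thesis using full1 full2 3 PQ c bx by (simp add: algebra_simps)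
    qed
  qed
qed

lemma fenchel_gap_bound:
  assumes \<alpha>: "\<alpha> > 0" and \<beta>: "\<beta> > 0"
    and sub1: "\<And>t. conj_density \<alpha> \<beta> a b + v * (t - a) \<le> conj_density \<alpha> \<beta> t b"
    and sub2: "\<And>t. conj_density \<alpha> \<beta> a b + w * (t - b) \<le> conj_density \<alpha> \<beta> a t"
  shows "\<alpha>/2 * (v\<^sup>2 + w\<^sup>2) + \<beta> * abs0 (v * w) + conj_density \<alpha> \<beta> a b
         \<le> v * a + w * b + \<beta> * gap_weight \<alpha> \<beta> a b"
proof (cases "\<bar>b\<bar> \<le> \<bar>a\<bar>")
  case True
  then show ?thesis using fenchel_gap_bound_ordered[OF \<alpha> \<beta> _ sub1 sub2] by blast
next
  case False
  then have "\<alpha>/2 * (w\<^sup>2 + v\<^sup>2) + \<beta> * abs0 (w * v) + conj_density \<alpha> \<beta> b a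
         \<le> w * b + v * a + \<beta> * gap_weight \<alpha> \<beta> b a"
    using sub1 sub2
    by (intro fenchel_gap_bound_ordered[OF \<alpha> \<beta>]) (simp_all add: conj_density_commute[of \<alpha> \<beta> b] conj_density_commute[of \<alpha> \<beta> _ a])
  then show ?thesis
    by (simp add: conj_density_commute[of \<alpha> \<beta> b] gap_weight_commute[of \<alpha> \<beta> b] algebra_simps)
qed

section \<open>The integrand and its conjugate\<close>

definition g_conj :: "real \<Rightarrow> real \<Rightarrow> real^2 \<Rightarrow> real" where
  "g_conj \<alpha> \<beta> q = conj_density \<alpha> \<beta> (q$1) (q$2)"

lemma inner_real2: "(v::real^2) \<bullet> q = v$1 * q$1 + v$2 * q$2"
  by (simp add: inner_vec_def UNIV_2)

lemma norm_sq_real2: "(norm (v::real^2))\<^sup>2 = (v$1)\<^sup>2 + (v$2)\<^sup>2"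
  unfolding power2_norm_eq_inner inner_real2 by (simp add: power2_eq_square)

text \<open>
  Young's inequality in each coordinate. A coordinate with \<open>v\<^sub>i = 0\<close> needs no share of \<open>g\<^sup>*\<close>,
  which is why the one-coordinate terms under the maximum suffice when \<open>g\<close> charges no \<open>\<beta>\<close>.
\<close>
lemma fenchel_young:
  assumes "\<alpha> > 0"
  shows "v \<bullet> q \<le> g_fun \<alpha> \<beta> v + g_conj \<alpha> \<beta> q"
proof -
  have young: "x * y \<le> \<alpha>/2 * x\<^sup>2 + y\<^sup>2/(2*\<alpha>)" for x y :: real
  proof -
    have "\<alpha>/2 * x\<^sup>2 + y\<^sup>2/(2*\<alpha>) - x * y = (\<alpha> * x - y)\<^sup>2 / (2*\<alpha>)"
      using assms by (simp add: field_simps power2_eq_square)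
    also have "\<dots> \<ge> 0" using assms by simp
    finally show ?thesis by simp
  qed
  have m: "(q$1)\<^sup>2/(2*\<alpha>) \<le> g_conj \<alpha> \<beta> q" "(q$2)\<^sup>2/(2*\<alpha>) \<le> g_conj \<alpha> \<beta> q"
    "(q$1)\<^sup>2/(2*\<alpha>) + (q$2)\<^sup>2/(2*\<alpha>) \<le> g_conj \<alpha> \<beta> q + \<beta>"
    by (auto simp: g_conj_def conj_density_def add_divide_distrib)
  consider "v$1 = 0" | "v$2 = 0" | "v$1 * v$2 \<noteq> 0" by fastforce
  then show ?thesis
    using young[of "v$1" "q$1"] young[of "v$2" "q$2"] m
    by cases (simp_all add: inner_real2 g_fun_def abs0_def distrib_left)
qed

text \<open>
  A Borel selection of maximizers of \<open>v \<mapsto> v \<cdot> q - g(v)\<close>, with ties broken arbitrarily: switching on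
  the second coordinate pays off only if the smaller of the two squares exceeds \<open>2\<alpha>\<beta>\<close>.
\<close>
definition conj_maximizer :: "real \<Rightarrow> real \<Rightarrow> real^2 \<Rightarrow> real^2" where
  "conj_maximizer \<alpha> \<beta> q =
     (if min ((q$1)\<^sup>2) ((q$2)\<^sup>2) \<le> 2*\<alpha>*\<beta>
      then if \<bar>q$2\<bar> \<le> \<bar>q$1\<bar> then (q$1 / \<alpha>) *\<^sub>R axis 1 1 else (q$2 / \<alpha>) *\<^sub>R axis 2 1
      else (1/\<alpha>) *\<^sub>R q)"

lemma conj_maximizer_attains:
  assumes \<alpha>: "\<alpha> > 0" and \<beta>: "\<beta> > 0"
  shows "conj_maximizer \<alpha> \<beta> q \<bullet> q = g_fun \<alpha> \<beta> (conj_maximizer \<alpha> \<beta> q) + g_conj \<alpha> \<beta> q"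
proof -
  define P where "P = (q$1)\<^sup>2/(2*\<alpha>)"
  define Q where "Q = (q$2)\<^sup>2/(2*\<alpha>)"
  have c: "g_conj \<alpha> \<beta> q = max (max P Q) (P + Q - \<beta>)"
    by (simp add: g_conj_def conj_density_def P_def Q_def add_divide_distrib)
  have thr: "min ((q$1)\<^sup>2) ((q$2)\<^sup>2) \<le> 2*\<alpha>*\<beta> \<longleftrightarrow> min P Q \<le> \<beta>"
    using \<alpha> by (auto simp: P_def Q_def min_le_iff_disj field_simps)
  have ord: "\<bar>q$2\<bar> \<le> \<bar>q$1\<bar> \<longleftrightarrow> Q \<le> P"
    using \<alpha> by (simp add: P_def Q_def abs_le_square_iff divide_le_cancel)
  have sq: "q$1 / \<alpha> * q$1 = 2 * P" "\<alpha>/2 * (q$1 / \<alpha>)\<^sup>2 = P"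
    "q$2 / \<alpha> * q$2 = 2 * Q" "\<alpha>/2 * (q$2 / \<alpha>)\<^sup>2 = Q"
    using \<alpha> by (simp_all add: P_def Q_def power2_eq_square)
  have ax: "axis 1 (1::real) $ (2::2) = 0" "axis 2 (1::real) $ (1::2) = 0"
    by (simp_all add: axis_def)
  consider "min P Q \<le> \<beta>" "Q \<le> P" | "min P Q \<le> \<beta>" "\<not> Q \<le> P" | "min P Q > \<beta>" by linarith
  then show ?thesis
  proof cases
    case 1
    then have "conj_maximizer \<alpha> \<beta> q = (q$1 / \<alpha>) *\<^sub>R axis 1 1"
      using thr ord by (simp add: conj_maximizer_def)
    then show ?thesis using 1 sq c ax by (simp add: inner_real2 g_fun_def abs0_def)
  next
    case 2
    then have "conj_maximizer \<alpha> \<beta> q = (q$2 / \<alpha>) *\<^sub>R axis 2 1"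
      using thr ord by (simp add: conj_maximizer_def)
    then show ?thesis using 2 sq c ax by (simp add: inner_real2 g_fun_def abs0_def)
  next
    case 3
    then have e: "conj_maximizer \<alpha> \<beta> q = (1 / \<alpha>) *\<^sub>R q"
      unfolding conj_maximizer_def thr by (simp add: min_le_iff_disj)
    \<comment> \<open>Both components are nonzero, so \<open>g\<close> does charge \<open>\<beta>\<close> here.\<close>
    have "q$1 \<noteq> 0" "q$2 \<noteq> 0" using 3 \<beta> by (auto simp: P_def Q_def)
    then have "abs0 (q$1 / \<alpha> * (q$2 / \<alpha>)) = 1" using \<alpha> by (simp add: abs0_def)
    then have "g_fun \<alpha> \<beta> ((1 / \<alpha>) *\<^sub>R q) = P + Q + \<beta>"
      using sq by (simp add: g_fun_def distrib_left)
    moreover have "((1 / \<alpha>) *\<^sub>R q) \<bullet> q = 2 * P + 2 * Q" using sq by (simp add: inner_real2)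
    ultimately show ?thesis using 3 c e by simp
  qed
qed

lemma norm_conj_maximizer_le:
  assumes "\<alpha> > 0"
  shows "norm (conj_maximizer \<alpha> \<beta> q) \<le> norm q / \<alpha>"
  using assms component_le_norm_cart[of q 1] component_le_norm_cart[of q 2]
  by (auto simp: conj_maximizer_def divide_right_mono)

lemma continuous_on_g_conj: "\<alpha> > 0 \<Longrightarrow> continuous_on UNIV (g_conj \<alpha> \<beta>)"
  unfolding g_conj_def conj_density_def by (intro continuous_intros) auto

lemma borel_measurable_vec_component [measurable]: "(\<lambda>v::real^2. v$i) \<in> borel_measurable borel"
  by (intro borel_measurable_continuous_onI continuous_intros)

lemma borel_measurable_g_conj: "g_conj \<alpha> \<beta> \<in> borel_measurable borel"
  unfolding g_conj_def conj_density_def by measurable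

lemma borel_measurable_g_fun: "g_fun \<alpha> \<beta> \<in> borel_measurable borel"
  unfolding g_fun_def abs0_def by measurable

lemma borel_measurable_conj_maximizer: "conj_maximizer \<alpha> \<beta> \<in> borel_measurable borel"
  unfolding conj_maximizer_def by measurable

lemma g_conj_bounds:
  assumes "\<alpha> > 0" and "\<beta> \<ge> 0"
  shows "0 \<le> g_conj \<alpha> \<beta> q" and "g_conj \<alpha> \<beta> q \<le> (norm q)\<^sup>2 / (2*\<alpha>)"
  using assms by (auto simp: g_conj_def conj_density_def norm_sq_real2 le_max_iff_disj
      add_divide_distrib)

lemma g_fun_bounds:
  assumes "\<alpha> > 0" and "\<beta> \<ge> 0"
  shows "0 \<le> g_fun \<alpha> \<beta> v" and "g_fun \<alpha> \<beta> v \<le> \<alpha>/2 * (norm v)\<^sup>2 + \<beta>"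
  using assms by (auto simp: g_fun_def abs0_def norm_sq_real2)

lemma gap_weight_eq_indicators:
  assumes \<alpha>: "\<alpha> > 0" and \<beta>: "\<beta> > 0"
  shows "gap_weight \<alpha> \<beta> (q$1) (q$2)
    = indicator (Q10 \<alpha> \<beta> \<union> Q20 \<alpha> \<beta>) q + 2 * indicator (Q12 \<alpha> \<beta> - {0}) q"
proof -
  have e: "\<bar>t\<bar> = sqrt (2*\<alpha>*\<beta>) \<longleftrightarrow> t\<^sup>2 = 2*\<alpha>*\<beta>" "\<bar>t\<bar> \<le> sqrt (2*\<alpha>*\<beta>) \<longleftrightarrow> t\<^sup>2 \<le> 2*\<alpha>*\<beta>" for t
    using real_sqrt_eq_iff[of "t\<^sup>2" "2*\<alpha>*\<beta>"] real_sqrt_le_iff[of "t\<^sup>2" "2*\<alpha>*\<beta>"] by auto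
  have z: "q = 0 \<longleftrightarrow> q$1 = 0 \<and> q$2 = 0" by (simp add: vec_eq_iff forall_2)
  consider (eq) "\<bar>q$1\<bar> = \<bar>q$2\<bar>" | (gt) "\<bar>q$2\<bar> < \<bar>q$1\<bar>" | (lt) "\<bar>q$1\<bar> < \<bar>q$2\<bar>" by linarith
  then show ?thesis
  proof cases
    case eq
    then have "(q$1)\<^sup>2 = (q$2)\<^sup>2" by (metis power2_abs)
    with eq show ?thesis by (auto simp: gap_weight_def Q10_def Q20_def Q12_def e z indicator_def)
  next
    case gt
    then have "(q$2)\<^sup>2 < (q$1)\<^sup>2" by (simp add: abs_le_square_iff[symmetric] not_le[symmetric])
    with gt show ?thesis
      by (auto simp: gap_weight_def Q10_def Q20_def Q12_def e z indicator_def)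
  next
    case lt
    then have "(q$1)\<^sup>2 < (q$2)\<^sup>2" by (simp add: abs_le_square_iff[symmetric] not_le[symmetric])
    with lt show ?thesis
      by (auto simp: gap_weight_def Q10_def Q20_def Q12_def e z indicator_def)
  qed
qed

lemma fenchel_gap_bound_vec:
  assumes \<alpha>: "\<alpha> > 0" and \<beta>: "\<beta> > 0"
    and sub: "\<And>r. g_conj \<alpha> \<beta> q + v \<bullet> (r - q) \<le> g_conj \<alpha> \<beta> r"
  shows "g_fun \<alpha> \<beta> v + g_conj \<alpha> \<beta> q \<le> v \<bullet> q
    + \<beta> * (indicator (Q10 \<alpha> \<beta> \<union> Q20 \<alpha> \<beta>) q + 2 * indicator (Q12 \<alpha> \<beta> - {0}) q)"
proof -
  have "conj_density \<alpha> \<beta> (q$1) (q$2) + v$1 * (t - q$1) \<le> conj_density \<alpha> \<beta> t (q$2)" for t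
    using sub[of "vector [t, q$2]"] by (simp add: g_conj_def inner_real2)
  moreover
  have "conj_density \<alpha> \<beta> (q$1) (q$2) + v$2 * (t - q$2) \<le> conj_density \<alpha> \<beta> (q$1) t" for t
    using sub[of "vector [q$1, t]"] by (simp add: g_conj_def inner_real2)
  ultimately show ?thesis
    using fenchel_gap_bound[OF \<alpha> \<beta>, of "q$1" "q$2" "v$1" "v$2"]
    by (simp add: gap_weight_eq_indicators[OF \<alpha> \<beta>, symmetric] g_conj_def g_fun_def inner_real2)
qed

section \<open>Square-integrable fields\<close>

lemma L2_iff: "u \<in> L2 D \<longleftrightarrow> u \<in> borel_measurable (lebesgue_on D)
    \<and> integrable (lebesgue_on D) (\<lambda>x. (norm (u x))\<^sup>2)"
  by (simp add: Lp_def)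

lemma L2_dominated:
  assumes "f \<in> borel_measurable (lebesgue_on D)" and "integrable (lebesgue_on D) h"
    and "\<And>x. (norm (f x))\<^sup>2 \<le> h x"
  shows "f \<in> L2 D"
proof -
  have [measurable]: "f \<in> borel_measurable (lebesgue_on D)" by fact
  have "AE x in lebesgue_on D. norm ((norm (f x))\<^sup>2) \<le> norm (h x)"
    using order_trans[OF assms(3) abs_ge_self] by simp
  then have "integrable (lebesgue_on D) (\<lambda>x. (norm (f x))\<^sup>2)"
    by (intro Bochner_Integration.integrable_bound[OF assms(2)]) measurable
  with assms(1) show ?thesis by (simp add: L2_iff)
qed

lemma L2_diff:
  assumes "u \<in> L2 D" and "v \<in> L2 D"
  shows "(\<lambda>x. u x - v x) \<in> L2 D"
proof (rule L2_dominated)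
  show "(\<lambda>x. u x - v x) \<in> borel_measurable (lebesgue_on D)"
    using assms by (auto simp: L2_iff)
  show "integrable (lebesgue_on D) (\<lambda>x. 2 * (norm (u x))\<^sup>2 + 2 * (norm (v x))\<^sup>2)"
    using assms by (auto simp: L2_iff)
  fix x
  have "(norm (u x - v x))\<^sup>2 + (norm (u x + v x))\<^sup>2 = 2 * (norm (u x))\<^sup>2 + 2 * (norm (v x))\<^sup>2"
    by (simp add: power2_norm_eq_inner algebra_simps inner_commute)
  then show "(norm (u x - v x))\<^sup>2 \<le> 2 * (norm (u x))\<^sup>2 + 2 * (norm (v x))\<^sup>2"
    using zero_le_power2[of "norm (u x + v x)"] by linarith
qed

lemma L2_integrable_inner:
  assumes "u \<in> L2 D" and "v \<in> L2 D"
  shows "integrable (lebesgue_on D) (\<lambda>x. u x \<bullet> v x)"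
proof (rule Bochner_Integration.integrable_bound)
  show "integrable (lebesgue_on D) (\<lambda>x. (norm (u x))\<^sup>2 + (norm (v x))\<^sup>2)"
    using assms by (auto simp: L2_iff)
  show "(\<lambda>x. u x \<bullet> v x) \<in> borel_measurable (lebesgue_on D)"
    using assms by (auto simp: L2_iff)
  have "\<bar>u x \<bullet> v x\<bar> \<le> (norm (u x))\<^sup>2 + (norm (v x))\<^sup>2" for x
  proof -
    have "\<bar>u x \<bullet> v x\<bar> \<le> norm (u x) * norm (v x)" by (rule Cauchy_Schwarz_ineq2)
    also have "\<dots> \<le> (norm (u x))\<^sup>2 + (norm (v x))\<^sup>2"
      using sum_squares_bound[of "norm (u x)" "norm (v x)"]
        mult_nonneg_nonneg[OF norm_ge_zero norm_ge_zero, of "u x" "v x"] by linarith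
    finally show ?thesis .
  qed
  then show "AE x in lebesgue_on D. norm (u x \<bullet> v x) \<le> norm ((norm (u x))\<^sup>2 + (norm (v x))\<^sup>2)"
    by simp
qed

lemma integrable_g_fun:
  assumes "D \<in> lmeasurable" "\<alpha> > 0" "\<beta> \<ge> 0" "u \<in> L2 D"
  shows "integrable (lebesgue_on D) (\<lambda>x. g_fun \<alpha> \<beta> (u x))"
proof (rule Bochner_Integration.integrable_bound)
  interpret finite_measure "lebesgue_on D" using assms(1) by (rule finite_measure_lebesgue_on)
  show "integrable (lebesgue_on D) (\<lambda>x. \<alpha>/2 * (norm (u x))\<^sup>2 + \<beta>)"
    using assms(4) by (auto simp: L2_iff)
  show "(\<lambda>x. g_fun \<alpha> \<beta> (u x)) \<in> borel_measurable (lebesgue_on D)"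
    by (rule measurable_compose[OF _ borel_measurable_g_fun]) (use assms(4) in \<open>simp add: L2_iff\<close>)
  show "AE x in lebesgue_on D. norm (g_fun \<alpha> \<beta> (u x)) \<le> norm (\<alpha>/2 * (norm (u x))\<^sup>2 + \<beta>)"
    unfolding real_norm_def abs_of_nonneg[OF g_fun_bounds(1)[OF assms(2,3)]]
    by (intro AE_I2 order_trans[OF g_fun_bounds(2)[OF assms(2,3)] abs_ge_self])
qed

lemma integrable_g_conj:
  assumes "\<alpha> > 0" "\<beta> \<ge> 0" "p \<in> L2 D"
  shows "integrable (lebesgue_on D) (\<lambda>x. g_conj \<alpha> \<beta> (p x))"
proof (rule Bochner_Integration.integrable_bound)
  show "integrable (lebesgue_on D) (\<lambda>x. (norm (p x))\<^sup>2 / (2*\<alpha>))"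
    using assms(3) by (auto simp: L2_iff)
  show "(\<lambda>x. g_conj \<alpha> \<beta> (p x)) \<in> borel_measurable (lebesgue_on D)"
    by (rule measurable_compose[OF _ borel_measurable_g_conj]) (use assms(3) in \<open>simp add: L2_iff\<close>)
  show "AE x in lebesgue_on D. norm (g_conj \<alpha> \<beta> (p x)) \<le> norm ((norm (p x))\<^sup>2 / (2*\<alpha>))"
    using g_conj_bounds[OF assms(1,2)] assms(1) by simp
qed

section \<open>The conjugate of the integral functional\<close>

lemma L2_inner_le_G_plus_conj:
  assumes "D \<in> lmeasurable" "\<alpha> > 0" "\<beta> \<ge> 0" "u \<in> L2 D" "p \<in> L2 D"
  shows "L2_inner D u p \<le> G_fun \<alpha> \<beta> D u + (\<integral>x. g_conj \<alpha> \<beta> (p x) \<partial>lebesgue_on D)"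
proof -
  note int = integrable_g_fun[OF assms(1-4)] integrable_g_conj[OF assms(2,3,5)]
  have "L2_inner D u p \<le> (\<integral>x. g_fun \<alpha> \<beta> (u x) + g_conj \<alpha> \<beta> (p x) \<partial>lebesgue_on D)"
    unfolding L2_inner_def
    by (intro integral_mono L2_integrable_inner assms int fenchel_young Bochner_Integration.integrable_add)
  also have "\<dots> = G_fun \<alpha> \<beta> D u + (\<integral>x. g_conj \<alpha> \<beta> (p x) \<partial>lebesgue_on D)"
    unfolding G_fun_def by (rule Bochner_Integration.integral_add[OF int])
  finally show ?thesis .
qed

text \<open>
  The inequality \<open>\<le>\<close> is the integrated Fenchel-Young inequality. The supremum is attained: composing
  \<open>p\<close> with \<open>conj_maximizer\<close> gives a field that lies in \<open>L\<^sup>2\<close> because its norm is at most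
  \<open>\<bar>p\<bar>/\<alpha>\<close>.
\<close>
lemma fenchel_conj_eq_integral:
  assumes "D \<in> lmeasurable" "\<alpha> > 0" "\<beta> > 0" "p \<in> L2 D"
  shows "fenchel_conj_L2 D (G_fun \<alpha> \<beta> D) p = ereal (\<integral>x. g_conj \<alpha> \<beta> (p x) \<partial>lebesgue_on D)"
    (is "?H = ereal ?I")
proof (rule antisym)
  show "?H \<le> ereal ?I"
    unfolding fenchel_conj_L2_def
    using L2_inner_le_G_plus_conj[OF assms(1,2) _ _ assms(4), of \<beta>] assms(3)
    by (intro SUP_least) (simp add: diff_le_eq add.commute)
next
  let ?u = "\<lambda>x. conj_maximizer \<alpha> \<beta> (p x)"
  have u: "?u \<in> L2 D"
  proof (rule L2_dominated)
    show "?u \<in> borel_measurable (lebesgue_on D)"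
      by (rule measurable_compose[OF _ borel_measurable_conj_maximizer]) (use assms(4) in \<open>simp add: L2_iff\<close>)
    show "integrable (lebesgue_on D) (\<lambda>x. (norm (p x))\<^sup>2 / \<alpha>\<^sup>2)"
      using assms(4) by (auto simp: L2_iff)
    show "(norm (?u x))\<^sup>2 \<le> (norm (p x))\<^sup>2 / \<alpha>\<^sup>2" for x
      using power_mono[OF norm_conj_maximizer_le[OF assms(2), of \<beta> "p x"] norm_ge_zero, of 2]
      by (simp add: power_divide)
  qed
  note int = integrable_g_fun[OF assms(1,2) less_imp_le[OF assms(3)] u]
    integrable_g_conj[OF assms(2) less_imp_le[OF assms(3)] assms(4)]
  have "L2_inner D ?u p = G_fun \<alpha> \<beta> D ?u + ?I"
    unfolding L2_inner_def G_fun_def conj_maximizer_attains[OF assms(2,3)]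
    by (rule Bochner_Integration.integral_add[OF int])
  then have "?I = L2_inner D ?u p - G_fun \<alpha> \<beta> D ?u" by simp
  then show "ereal ?I \<le> ?H"
    unfolding fenchel_conj_L2_def by (intro SUP_upper2[OF u]) simp
qed

text \<open>
  Localization of the subgradient inequality. For a fixed vector \<open>q\<close>, testing with the field that
  equals \<open>q\<close> where the pointwise inequality fails and \<open>p\<close> elsewhere shows that it fails only on a
  null set. Countably many \<open>q\<close> can be treated at once, and a dense set of them suffices because
  \<open>g\<^sup>*\<close> is continuous.
\<close>
lemma subdifferential_pointwise:
  assumes D: "D \<in> lmeasurable" and \<alpha>: "\<alpha> > 0" and \<beta>: "\<beta> > 0" and p: "p \<in> L2 D"
    and sub: "u \<in> subdifferential_L2 D (fenchel_conj_L2 D (G_fun \<alpha> \<beta> D)) p"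
  shows "AE x in lebesgue_on D. \<forall>q. g_conj \<alpha> \<beta> (p x) + u x \<bullet> (q - p x) \<le> g_conj \<alpha> \<beta> q"
proof -
  interpret finite_measure "lebesgue_on D" using D by (rule finite_measure_lebesgue_on)
  have u: "u \<in> L2 D" using sub by (simp add: subdifferential_L2_def)
  note conj = fenchel_conj_eq_integral[OF D \<alpha> \<beta>] and int_conj = integrable_g_conj[OF \<alpha> less_imp_le[OF \<beta>]]
  have [measurable]: "u \<in> borel_measurable (lebesgue_on D)" "p \<in> borel_measurable (lebesgue_on D)"
    using u p by (auto simp: L2_iff)
  have [measurable]: "g_conj \<alpha> \<beta> \<in> borel_measurable borel" by (rule borel_measurable_g_conj)
  have global: "(\<integral>x. g_conj \<alpha> \<beta> (p x) \<partial>lebesgue_on D) + L2_inner D u (\<lambda>x. r x - p x)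
      \<le> (\<integral>x. g_conj \<alpha> \<beta> (r x) \<partial>lebesgue_on D)" if "r \<in> L2 D" for r
    using sub that by (simp add: subdifferential_L2_def conj p)
  have single: "AE x in lebesgue_on D. g_conj \<alpha> \<beta> (p x) + u x \<bullet> (q - p x) \<le> g_conj \<alpha> \<beta> q" for q
  proof -
    define d where "d = (\<lambda>x. g_conj \<alpha> \<beta> q - g_conj \<alpha> \<beta> (p x) - u x \<bullet> (q - p x))"
    define r where "r = (\<lambda>x. if d x < 0 then q else p x)"
    have [measurable]: "d \<in> borel_measurable (lebesgue_on D)" unfolding d_def by measurable
    have r: "r \<in> L2 D"
    proof (rule L2_dominated)
      show "r \<in> borel_measurable (lebesgue_on D)" unfolding r_def by measurable
      show "integrable (lebesgue_on D) (\<lambda>x. (norm q)\<^sup>2 + (norm (p x))\<^sup>2)"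
        using p by (auto simp: L2_iff)
      show "(norm (r x))\<^sup>2 \<le> (norm q)\<^sup>2 + (norm (p x))\<^sup>2" for x by (simp add: r_def)
    qed
    note ints = int_conj[OF r] int_conj[OF p] L2_integrable_inner[OF u L2_diff[OF r p]]
    have m: "min 0 (d x) = g_conj \<alpha> \<beta> (r x) - g_conj \<alpha> \<beta> (p x) - u x \<bullet> (r x - p x)" for x
      by (auto simp: r_def d_def)
    have int_m: "integrable (lebesgue_on D) (\<lambda>x. - min 0 (d x))"
      unfolding m using ints by auto
    have "(\<integral>x. - min 0 (d x) \<partial>lebesgue_on D) \<le> 0"
      unfolding m using ints global[OF r] by (simp add: L2_inner_def)
    moreover have "(\<integral>x. - min 0 (d x) \<partial>lebesgue_on D) \<ge> 0"
      by (intro integral_nonneg_AE) auto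
    ultimately have "AE x in lebesgue_on D. - min 0 (d x) = 0"
      using integral_nonneg_eq_0_iff_AE[OF int_m] by auto
    then show ?thesis by eventually_elim (auto simp: d_def min_def split: if_splits)
  qed
  obtain Q :: "(real^2) set" where Q: "countable Q" "\<And>X. open X \<Longrightarrow> X \<noteq> {} \<Longrightarrow> \<exists>q\<in>Q. q \<in> X"
    using countable_dense_setE by blast
  have dense: "closure Q = UNIV"
    using Q(2)[of "- closure Q"] closure_subset[of Q] by auto
  have "AE x in lebesgue_on D. \<forall>q\<in>Q. g_conj \<alpha> \<beta> (p x) + u x \<bullet> (q - p x) \<le> g_conj \<alpha> \<beta> q"
    using single Q(1) by (intro AE_ball_countable') auto
  then show ?thesis
  proof eventually_elim
    case (elim x)
    show ?case
    proof
      fix q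
      have "continuous_on (closure Q) (\<lambda>q. g_conj \<alpha> \<beta> q - g_conj \<alpha> \<beta> (p x) - u x \<bullet> (q - p x))"
        unfolding dense using continuous_on_g_conj[OF \<alpha>] by (intro continuous_intros) auto
      then have "0 \<le> g_conj \<alpha> \<beta> q - g_conj \<alpha> \<beta> (p x) - u x \<bullet> (q - p x)"
        by (rule continuous_ge_on_closure) (use elim dense in \<open>auto simp: diff_le_eq le_diff_eq add.commute\<close>)
      then show "g_conj \<alpha> \<beta> (p x) + u x \<bullet> (q - p x) \<le> g_conj \<alpha> \<beta> q" by simp
    qed
  qed
qed

section \<open>Suboptimality of the stationary field\<close>

lemma integrated_fenchel_gap:
  assumes D: "D \<in> lmeasurable" and \<alpha>: "\<alpha> > 0" and \<beta>: "\<beta> > 0" and p: "p \<in> L2 D"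
    and sub: "u \<in> subdifferential_L2 D (fenchel_conj_L2 D (G_fun \<alpha> \<beta> D)) p"
  shows "G_fun \<alpha> \<beta> D u + (\<integral>x. g_conj \<alpha> \<beta> (p x) \<partial>lebesgue_on D)
    \<le> L2_inner D u p + \<beta> * (measure lebesgue (boundary_set \<alpha> \<beta> D p)
                            + 2 * measure lebesgue (singular_set \<alpha> \<beta> D p))"
proof -
  let ?M = "lebesgue_on D"
  interpret finite_measure ?M using D by (rule finite_measure_lebesgue_on)
  have u: "u \<in> L2 D" using sub by (simp add: subdifferential_L2_def)
  have Ds: "D \<in> sets lebesgue" using D by (rule fmeasurableD)
  have [measurable]: "p \<in> borel_measurable ?M" using p by (simp add: L2_iff)
  have q: "Q10 \<alpha> \<beta> \<union> Q20 \<alpha> \<beta> \<in> sets borel" "Q12 \<alpha> \<beta> - {0} \<in> sets borel"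
    unfolding Q10_def Q20_def Q12_def by measurable
  let ?B = "boundary_set \<alpha> \<beta> D p" and ?S = "singular_set \<alpha> \<beta> D p"
  have "?B = p -` (Q10 \<alpha> \<beta> \<union> Q20 \<alpha> \<beta>) \<inter> space ?M" "?S = p -` (Q12 \<alpha> \<beta> - {0}) \<inter> space ?M"
    by (auto simp: boundary_set_def singular_set_def)
  with q have sets [measurable]: "?B \<in> sets ?M" "?S \<in> sets ?M"
    by (simp_all only: measurable_sets[OF \<open>p \<in> borel_measurable ?M\<close>])
  have meas: "measure ?M ?B = measure lebesgue ?B" "measure ?M ?S = measure lebesgue ?S"
    using Ds by (auto intro!: measure_restrict_space simp: boundary_set_def singular_set_def)
  have sub_D: "?B \<inter> D = ?B" "?S \<inter> D = ?S" by (auto simp: boundary_set_def singular_set_def)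
  have ind: "integrable ?M (\<lambda>x. indicator ?B x :: real)" "integrable ?M (\<lambda>x. indicator ?S x :: real)"
    using sets by (simp_all add: less_top[symmetric])
  note int = integrable_g_fun[OF D \<alpha> less_imp_le[OF \<beta>] u] integrable_g_conj[OF \<alpha> less_imp_le[OF \<beta>] p]
    L2_integrable_inner[OF u p]
  have "AE x in ?M. g_fun \<alpha> \<beta> (u x) + g_conj \<alpha> \<beta> (p x)
      \<le> u x \<bullet> p x + \<beta> * (indicator ?B x + 2 * indicator ?S x)"
    using subdifferential_pointwise[OF D \<alpha> \<beta> p sub] AE_space
  proof eventually_elim
    case (elim x)
    then show ?case
      using fenchel_gap_bound_vec[OF \<alpha> \<beta>, of "p x" "u x"]
      by (simp add: boundary_set_def singular_set_def indicator_def)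
  qed
  then have "(\<integral>x. g_fun \<alpha> \<beta> (u x) + g_conj \<alpha> \<beta> (p x) \<partial>?M)
      \<le> (\<integral>x. u x \<bullet> p x + \<beta> * (indicator ?B x + 2 * indicator ?S x) \<partial>?M)"
    using int ind by (intro integral_mono_AE) auto
  then show ?thesis
    using int ind by (simp add: G_fun_def L2_inner_def meas sub_D)
qed

text \<open>
  The subgradient inequality for \<open>\<F>\<close> at \<open>u\<^sub>0\<close>, whose gradient there is
  \<open>S\<^sup>*(S u\<^sub>0 - z) = -p\<close>; the term dropped is \<open>\<parallel>S(u - u\<^sub>0)\<parallel>\<^sup>2/2\<close>.
\<close>
lemma F_fun_convexity:
  assumes S: "bounded_linear_L2 D S" and adj: "is_adjoint_L2 D S Sadj"
    and u0: "u0 \<in> L2 D" and p: "p \<in> L2 D" and u: "u \<in> L2 D"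
    and p_eq: "AE x in lebesgue_on D. p x = - Sadj (S u0 - z) x"
  shows "F_fun S z u0 + L2_inner D u0 p \<le> F_fun S z u + L2_inner D u p"
proof -
  let ?h = "\<lambda>x. u x - u0 x"
  have h: "?h \<in> L2 D" by (rule L2_diff[OF u u0])
  have "S (\<lambda>x. u0 x + ?h x) = S u0 + S ?h"
    using S[unfolded bounded_linear_L2_def, THEN conjunct1, rule_format, OF u0 h] .
  then have Su: "S u - z = (S u0 - z) + S ?h" by simp
  have adjy: "Sadj (S u0 - z) \<in> L2 D" and "S ?h \<bullet> (S u0 - z) = L2_inner D ?h (Sadj (S u0 - z))"
    using adj h unfolding is_adjoint_L2_def by blast+
  moreover have "L2_inner D ?h (Sadj (S u0 - z)) = (\<integral>x. - (?h x \<bullet> p x) \<partial>lebesgue_on D)"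
    unfolding L2_inner_def
  proof (rule integral_cong_AE)
    show "AE x in lebesgue_on D. ?h x \<bullet> Sadj (S u0 - z) x = - (?h x \<bullet> p x)"
      using p_eq by eventually_elim simp
  qed (use h p adjy in \<open>auto simp: L2_iff\<close>)
  moreover have "\<dots> = L2_inner D u0 p - L2_inner D u p"
    using L2_integrable_inner[OF u p] L2_integrable_inner[OF u0 p]
    by (simp add: L2_inner_def inner_diff_left)
  ultimately have "S ?h \<bullet> (S u0 - z) = L2_inner D u0 p - L2_inner D u p" by simp
  moreover have "F_fun S z u = F_fun S z u0 + S ?h \<bullet> (S u0 - z) + 1/2 * (norm (S ?h))\<^sup>2"
    unfolding F_fun_def Su by (simp add: power2_norm_eq_inner algebra_simps inner_commute)
  ultimately show ?thesis by simp
qed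

theorem theorem4p2:
  fixes D :: "(real^'d::finite) set"
    and \<alpha> \<beta> r :: real
    and S :: "'d field2 \<Rightarrow> 'y::{real_inner, banach}"
    and Sadj :: "'y \<Rightarrow> 'd field2"
    and z :: 'y
    and emb :: "'v::banach \<Rightarrow> 'd field2"
    and T :: "'y \<Rightarrow> 'v"
    and ubar pbar :: "'d field2"
  assumes "D \<in> lmeasurable"
    and "\<alpha> > 0" and "\<beta> > 0"
    and "bounded_linear_L2 D S"
    and "is_adjoint_L2 D S Sadj"
    and "r > 2"
    and "continuous_embedding_Lp r D emb"
    and "continuous_on UNIV T"
    and "\<And>y. AE x in lebesgue_on D. Sadj y x = emb (T y) x"
    and "ubar \<in> L2 D" and "pbar \<in> L2 D"
    and "AE x in lebesgue_on D. pbar x = - Sadj (S ubar - z) x"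
    and "ubar \<in> subdifferential_L2 D (fenchel_conj_L2 D (G_fun \<alpha> \<beta> D)) pbar"
  shows "(\<forall>u\<in>L2 D. J_fun \<alpha> \<beta> D S z ubar \<le> J_fun \<alpha> \<beta> D S z u
            + \<beta> * (measure lebesgue (boundary_set \<alpha> \<beta> D pbar)
                   + 2 * measure lebesgue (singular_set \<alpha> \<beta> D pbar)))
       \<and> (boundary_set \<alpha> \<beta> D pbar \<in> null_sets lebesgue
            \<and> singular_set \<alpha> \<beta> D pbar \<in> null_sets lebesgue
            \<longrightarrow> is_arg_min (J_fun \<alpha> \<beta> D S z) (\<lambda>u. u \<in> L2 D) ubar)"
proof -
  note D = assms(1) and \<alpha> = assms(2) and \<beta> = assms(3) and ubar = assms(10) and pbar = assms(11)
  let ?gap = "\<beta> * (measure lebesgue (boundary_set \<alpha> \<beta> D pbar)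
                   + 2 * measure lebesgue (singular_set \<alpha> \<beta> D pbar))"
  have bound: "J_fun \<alpha> \<beta> D S z ubar \<le> J_fun \<alpha> \<beta> D S z u + ?gap" if u: "u \<in> L2 D" for u
    using F_fun_convexity[OF assms(4,5) ubar pbar u assms(12)]
      integrated_fenchel_gap[OF D \<alpha> \<beta> pbar assms(13)]
      L2_inner_le_G_plus_conj[OF D \<alpha> less_imp_le[OF \<beta>] u pbar]
    unfolding J_fun_def by linarith
  moreover have "is_arg_min (J_fun \<alpha> \<beta> D S z) (\<lambda>u. u \<in> L2 D) ubar"
    if "boundary_set \<alpha> \<beta> D pbar \<in> null_sets lebesgue" "singular_set \<alpha> \<beta> D pbar \<in> null_sets lebesgue"
  proof -
    have "?gap = 0" using that by (simp add: measure_eq_0_null_sets)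
    then show ?thesis using bound ubar by (fastforce simp: is_arg_min_def not_less)
  qed
  ultimately show ?thesis by blast
qed

end
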